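(* Let $n\ge3$ be an integer and let $B,C\subseteq\{1,\ldots,n-1\}$. Let $A=A(n;B,C)$ with its defining numbering of vertices $V(A)=\{a_1,a_2,\ldots,a_n\}$, and let $A'=A(n;C,B)$ with its defining numbering of vertices $V(A')=\{b_1,b_2,\ldots,b_n\}$. Let $a'_i:=b_{n-i+1}$ for $i=1,\ldots,n$ (hence $V(A')=\{a'_1,a'_2,\ldots,a'_n\}$). Then the following two statements are equivalent: (i) $\beta(A)=\gamma(A)$. (ii) $|E(A)|=|E(A')|$, $\deg_A a_1=\deg_{A'}a'_1$ and $\deg_A a_n=\deg_{A'}a'_n$.
   Context: For an integer $n\ge3$ and subsets $B,C\subseteq\{1,\ldots,n-1\}$, $A(n;B,C)$ is the finite simple graph with $n$ vertices $a_1,\ldots,a_n$ and edge set $$\{[a_{2t-1},a_{2t-1+b}] : b\in B,\ t\in\mathbb{N},\ 1\le 2t-1<2t-1+b\le n\}\ \cup\ \{[a_{2t},a_{2t+c}] : c\in C,\ t\in\mathbb{N},\ 2\le 2t<2t+c\le n\}.$$ For $A=A(n;B,C)$, $\beta(A):=\#\{b\in B : n-b\text{ is odd}\}$ and $\gamma(A):=\#\{c\in C : n-c\text{ is odd}\}$ (these depend on the data $(n;B,C)$). $\deg_A v$ is the degree of the vertex $v$ in the graph $A$. *)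

theory Defs
  imports Main
begin

record 'v ugraph =
  verts :: "'v set"
  edges :: "'v set set"

definition fin_simple_graph :: "'v ugraph \<Rightarrow> bool" where
  "fin_simple_graph G \<longleftrightarrow> finite (verts G) \<and> (\<forall>e\<in>edges G. e \<subseteq> verts G \<and> card e = 2)"

definition degree :: "'v ugraph \<Rightarrow> 'v \<Rightarrow> nat" where
  "degree G v = card {e \<in> edges G. v \<in> e}"

text \<open>
  The graph $A(n;B,C)$. The argument \<open>a\<close> is the defining numbering \<open>a 1, \<dots>, a n\<close> of the
  vertices; it is meant to be injective on \<open>{1..n}\<close>, and its values outside \<open>{1..n}\<close> play no role.
  For \<open>t = 0\<close> the natural-number term \<open>2 * t - 1\<close> truncates to \<open>0\<close>, which the
  condition \<open>1 \<le> 2 * t - 1\<close> excludes.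
\<close>

definition A_graph :: "(nat \<Rightarrow> 'v) \<Rightarrow> nat \<Rightarrow> nat set \<Rightarrow> nat set \<Rightarrow> 'v ugraph" where
  "A_graph a n B C = \<lparr>
     verts = a ` {1..n},
     edges = {{a (2 * t - 1), a (2 * t - 1 + b)} | b t.
                b \<in> B \<and> 1 \<le> 2 * t - 1 \<and> 2 * t - 1 < 2 * t - 1 + b \<and> 2 * t - 1 + b \<le> n}
           \<union> {{a (2 * t), a (2 * t + c)} | c t.
                c \<in> C \<and> 2 \<le> 2 * t \<and> 2 * t < 2 * t + c \<and> 2 * t + c \<le> n} \<rparr>"

text \<open>
  \<open>\<beta>\<close> and \<open>\<gamma>\<close> are functions of the data $(n;B,C)$, not of the resulting graph.
\<close>

definition beta :: "nat \<Rightarrow> nat set \<Rightarrow> nat set \<Rightarrow> nat" where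
  "beta n B C = card {b \<in> B. odd (n - b)}"

definition gamma :: "nat \<Rightarrow> nat set \<Rightarrow> nat set \<Rightarrow> nat" where
  "gamma n B C = card {c \<in> C. odd (n - c)}"

lemma fin_simple_graph_A_graph:
  assumes "inj_on a {1..n}"
  shows "fin_simple_graph (A_graph a n B C)"
proof -
  have pair: "{a i, a j} \<subseteq> a ` {1..n} \<and> card {a i, a j} = 2"
    if "1 \<le> i" "i < j" "j \<le> n" for i j
  proof -
    have "a i \<noteq> a j"
      using inj_onD[OF assms, of i j] that by auto
    then show ?thesis using that by auto
  qed
  have "e \<subseteq> a ` {1..n} \<and> card e = 2" if "e \<in> edges (A_graph a n B C)" for e
  proof -
    obtain i j where "e = {a i, a j}" "1 \<le> i" "i < j" "j \<le> n"
      using \<open>e \<in> edges (A_graph a n B C)\<close> unfolding A_graph_def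
      by (auto; metis One_nat_def Suc_leI add_gr_0 less_add_same_cancel1 nat_0_less_mult_iff zero_less_numeral)
    then show ?thesis using pair by blast
  qed
  then show ?thesis
    by (auto simp: fin_simple_graph_def A_graph_def)
qed

end

theory Submission
  imports Defs
begin

text \<open>
  A difference \<open>d\<close> labels the edges starting at the odd (or even) \<open>i\<close> with \<open>1 \<le> i \<le> n - d\<close>; there
  are \<open>(n - d) div 2\<close> even ones, and one more odd one exactly if \<open>n - d\<close> is odd. Hence the edge
  number of $A(n;B,C)$ is \<open>\<beta>\<close> plus a quantity symmetric in \<open>B\<close> and \<open>C\<close>, and comparing edge numbers
  amounts to comparing \<open>\<beta>\<close> with \<open>\<gamma>\<close>. The degree conditions come for free: the first
  vertex has degree \<open>|B|\<close> and the last one has degree \<open>\<beta> + |C| - \<gamma>\<close>.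
\<close>

text \<open>Edges are replaced by index pairs with the smaller index first, whose parity selects
  \<open>B\<close> or \<open>C\<close>. Counting then happens in the naturals, away from the
  numbering \<open>a\<close>.\<close>

definition edge_pairs :: "nat \<Rightarrow> nat set \<Rightarrow> nat set \<Rightarrow> (nat \<times> nat) set" where
  "edge_pairs n B C =
    {(i, j). 1 \<le> i \<and> i < j \<and> j \<le> n \<and> j - i \<in> (if odd i then B else C)}"

lemma edges_A_graph: "edges (A_graph a n B C) = (\<lambda>(i, j). {a i, a j}) ` edge_pairs n B C"
proof (intro equalityI subsetI)
  fix e assume "e \<in> edges (A_graph a n B C)"
  then consider
      (odd) t d where "e = {a (2 * t - 1), a (2 * t - 1 + d)}" "d \<in> B" "1 \<le> 2 * t - 1"
        "2 * t - 1 < 2 * t - 1 + d" "2 * t - 1 + d \<le> n"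
    | (even) t d where "e = {a (2 * t), a (2 * t + d)}" "d \<in> C" "2 \<le> 2 * t"
        "2 * t < 2 * t + d" "2 * t + d \<le> n"
    unfolding A_graph_def ugraph.select_convs by blast
  then show "e \<in> (\<lambda>(i, j). {a i, a j}) ` edge_pairs n B C"
  proof cases
    case odd
    have "(2 * t - 1, 2 * t - 1 + d) \<in> edge_pairs n B C"
      using odd by (auto simp: edge_pairs_def)
    then show ?thesis using odd(1) by force
  next
    case even
    have "(2 * t, 2 * t + d) \<in> edge_pairs n B C"
      using even by (auto simp: edge_pairs_def)
    then show ?thesis using even(1) by force
  qed
next
  fix e assume "e \<in> (\<lambda>(i, j). {a i, a j}) ` edge_pairs n B C"
  then obtain i j where e: "e = {a i, a j}" and ij: "1 \<le> i" "i < j" "j \<le> n"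
    and d: "j - i \<in> (if odd i then B else C)"
    by (auto simp: edge_pairs_def)
  show "e \<in> edges (A_graph a n B C)"
  proof (cases "odd i")
    case True
    then obtain s where "i = 2 * s + 1" by (rule oddE)
    \<comment> \<open>The defining edge set writes odd indices as \<open>2 * t - 1\<close>, so the
      witness for \<open>t\<close> is \<open>s + 1\<close>.\<close>
    then have "i = 2 * (s + 1) - 1" by simp
    moreover have "j = i + (j - i)" using ij by simp
    ultimately have "\<exists>d t. e = {a (2 * t - 1), a (2 * t - 1 + d)} \<and> d \<in> B \<and> 1 \<le> 2 * t - 1 \<and>
        2 * t - 1 < 2 * t - 1 + d \<and> 2 * t - 1 + d \<le> n"
      using e ij d True by (intro exI[of _ "j - i"] exI[of _ "s + 1"]) auto
    then show ?thesis unfolding A_graph_def by simp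
  next
    case False
    then obtain t where "i = 2 * t" by auto
    moreover have "j = i + (j - i)" using ij by simp
    ultimately have "\<exists>d t. e = {a (2 * t), a (2 * t + d)} \<and> d \<in> C \<and> 2 \<le> 2 * t \<and>
        2 * t < 2 * t + d \<and> 2 * t + d \<le> n"
      using e ij d False by (intro exI[of _ "j - i"] exI[of _ t]) auto
    then show ?thesis unfolding A_graph_def by simp
  qed
qed

text \<open>Since \<open>a\<close> is injective, an edge determines its set of two indices, and the
  order \<open>i < j\<close> excludes the swapped pair.\<close>

lemma inj_on_edge_pairs:
  assumes "inj_on a {1..n}"
  shows "inj_on (\<lambda>(i, j). {a i, a j}) (edge_pairs n B C)"
proof (rule inj_onI, clarify)
  fix i j k l
  assume "(i, j) \<in> edge_pairs n B C" "(k, l) \<in> edge_pairs n B C" and eq: "{a i, a j} = {a k, a l}"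
  then have ij: "i \<in> {1..n}" "j \<in> {1..n}" "i < j" and kl: "k \<in> {1..n}" "l \<in> {1..n}" "k < l"
    by (auto simp: edge_pairs_def)
  have "a ` {i, j} = a ` {k, l}" using eq by simp
  then have "{i, j} = {k, l}"
    using inj_on_image_eq_iff[OF assms, of "{i, j}" "{k, l}"] ij kl by simp
  then show "i = k \<and> j = l" using ij kl by (auto simp: doubleton_eq_iff)
qed

lemma card_edges_A_graph:
  assumes "inj_on a {1..n}"
  shows "card (edges (A_graph a n B C)) = card (edge_pairs n B C)"
  by (simp add: edges_A_graph card_image inj_on_edge_pairs[OF assms])

lemma degree_A_graph:
  assumes "inj_on a {1..n}" and "k \<in> {1..n}"
  shows "degree (A_graph a n B C) (a k) = card {(i, j) \<in> edge_pairs n B C. i = k \<or> j = k}"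
proof -
  have eq: "a k = a i \<longleftrightarrow> k = i" if "i \<in> {1..n}" for i
    using inj_on_eq_iff[OF assms(1)] assms(2) that by blast
  have "{e \<in> edges (A_graph a n B C). a k \<in> e}
      = (\<lambda>(i, j). {a i, a j}) ` {p \<in> edge_pairs n B C. a k \<in> (case p of (i, j) \<Rightarrow> {a i, a j})}"
    unfolding edges_A_graph by blast
  also have "{p \<in> edge_pairs n B C. a k \<in> (case p of (i, j) \<Rightarrow> {a i, a j})}
      = {(i, j) \<in> edge_pairs n B C. i = k \<or> j = k}"
    by (auto simp: edge_pairs_def eq)
  finally have "degree (A_graph a n B C) (a k)
      = card ((\<lambda>(i, j). {a i, a j}) ` {(i, j) \<in> edge_pairs n B C. i = k \<or> j = k})"
    unfolding degree_def by simp
  also have "\<dots> = card {(i, j) \<in> edge_pairs n B C. i = k \<or> j = k}"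
    by (rule card_image, rule inj_on_subset[OF inj_on_edge_pairs[OF assms(1)]]) auto
  finally show ?thesis .
qed

text \<open>Index 1 is odd and never the larger end of a pair, so its edges correspond to the
  differences in \<open>B\<close>; each of them fits because \<open>d \<le> n - 1\<close>.\<close>

lemma degree_A_graph_first:
  assumes "inj_on a {1..n}" and "B \<subseteq> {1..n - 1}" and "n \<ge> 1"
  shows "degree (A_graph a n B C) (a 1) = card B"
proof -
  have "{(i, j) \<in> edge_pairs n B C. i = 1 \<or> j = 1} = (\<lambda>d. (1::nat, 1 + d)) ` B"
  proof (intro equalityI subsetI)
    fix p assume "p \<in> {(i, j) \<in> edge_pairs n B C. i = 1 \<or> j = 1}"
    then obtain j where "p = (1, j)" "1 < j" "j - 1 \<in> B"
      by (auto simp: edge_pairs_def)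
    then show "p \<in> (\<lambda>d. (1::nat, 1 + d)) ` B"
      by (intro image_eqI[of _ _ "j - 1"]) auto
  next
    fix p assume "p \<in> (\<lambda>d. (1::nat, 1 + d)) ` B"
    then obtain d where "p = (1, 1 + d)" "d \<in> B" by blast
    moreover have "1 \<le> d" "1 + d \<le> n" using \<open>d \<in> B\<close> assms(2,3) by force+
    ultimately show "p \<in> {(i, j) \<in> edge_pairs n B C. i = 1 \<or> j = 1}"
      by (simp add: edge_pairs_def)
  qed
  moreover have "card ((\<lambda>d. (1::nat, 1 + d)) ` B) = card B"
    by (rule card_image) (simp add: inj_on_def)
  ultimately show ?thesis
    using degree_A_graph[OF assms(1), of 1] assms(3) by simp
qed

text \<open>Index \<open>n\<close> is always the larger end. Difference \<open>d\<close> leads back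
  to \<open>n - d\<close>, whose parity decides whether \<open>d\<close> must lie in
  \<open>B\<close> or in \<open>C\<close>. The additive form avoids truncated subtraction.\<close>

lemma degree_A_graph_last:
  assumes "inj_on a {1..n}" and "B \<subseteq> {1..n - 1}" and "C \<subseteq> {1..n - 1}" and "n \<ge> 1"
  shows "degree (A_graph a n B C) (a n) + gamma n B C = beta n B C + card C"
proof -
  let ?B = "{d \<in> B. odd (n - d)}" and ?C = "{d \<in> C. even (n - d)}" and ?C' = "{d \<in> C. odd (n - d)}"
  have fin: "finite B" "finite C" using assms(2,3) finite_subset by blast+
  have pairs: "{(i, j) \<in> edge_pairs n B C. i = n \<or> j = n}
      = (\<lambda>d. (n - d, n)) ` ?B \<union> (\<lambda>d. (n - d, n)) ` ?C"
  proof (intro equalityI subsetI)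
    fix p assume "p \<in> {(i, j) \<in> edge_pairs n B C. i = n \<or> j = n}"
    then obtain i where "p = (i, n)" "i < n" "n - i \<in> (if odd i then B else C)"
      by (auto simp: edge_pairs_def)
    then show "p \<in> (\<lambda>d. (n - d, n)) ` ?B \<union> (\<lambda>d. (n - d, n)) ` ?C"
      \<comment> \<open>Merging the two images lets the single witness \<open>n - i\<close> serve
        both parities of \<open>i\<close>.\<close>
      unfolding image_Un[symmetric] by (intro image_eqI[of _ _ "n - i"]) (auto split: if_splits)
  next
    fix p assume "p \<in> (\<lambda>d. (n - d, n)) ` ?B \<union> (\<lambda>d. (n - d, n)) ` ?C"
    then obtain d where p: "p = (n - d, n)" and d: "d \<in> ?B \<union> ?C" by blast
    have "1 \<le> d" "d \<le> n - 1" using d assms(2,3) by auto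
    then show "p \<in> {(i, j) \<in> edge_pairs n B C. i = n \<or> j = n}"
      using p d assms(4) by (auto simp: edge_pairs_def)
  qed
  \<comment> \<open>Truncated subtraction from \<open>n\<close> is injective here because all
    differences are at most \<open>n - 1\<close>.\<close>
  have inj: "inj_on (\<lambda>d. (n - d, n)) (B \<union> C)"
  proof (rule inj_onI)
    fix d d' assume "d \<in> B \<union> C" "d' \<in> B \<union> C" and eq: "(n - d, n) = (n - d', n)"
    then have "d \<in> {1..n - 1}" "d' \<in> {1..n - 1}" using assms(2,3) by blast+
    then show "d = d'" using eq by auto
  qed
  have "degree (A_graph a n B C) (a n)
      = card ((\<lambda>d. (n - d, n)) ` ?B \<union> (\<lambda>d. (n - d, n)) ` ?C)"
    using assms by (simp add: degree_A_graph pairs)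
  also have "\<dots> = card ((\<lambda>d. (n - d, n)) ` ?B) + card ((\<lambda>d. (n - d, n)) ` ?C)"
  \<comment> \<open>\<open>B\<close> and \<open>C\<close> may overlap; the images are separated by
    the parity of the smaller index.\<close>
  proof (rule card_Un_disjoint)
    have "odd (fst p)" if "p \<in> (\<lambda>d. (n - d, n)) ` ?B" for p
      using that by auto
    moreover have "even (fst p)" if "p \<in> (\<lambda>d. (n - d, n)) ` ?C" for p
      using that by auto
    ultimately show "(\<lambda>d. (n - d, n)) ` ?B \<inter> (\<lambda>d. (n - d, n)) ` ?C = {}"
      by blast
  qed (use fin in auto)
  also have "card ((\<lambda>d. (n - d, n)) ` ?B) = card ?B"
    by (rule card_image, rule inj_on_subset[OF inj]) auto
  also have "card ((\<lambda>d. (n - d, n)) ` ?C) = card ?C"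
    by (rule card_image, rule inj_on_subset[OF inj]) auto
  finally have deg: "degree (A_graph a n B C) (a n) = card ?B + card ?C" .
  have "card ?C + card ?C' = card (?C \<union> ?C')"
    using fin by (subst card_Un_disjoint) auto
  also have "?C \<union> ?C' = C" by blast
  finally show ?thesis using deg by (simp add: beta_def gamma_def)
qed

lemma card_evens_atMost: "card {i \<in> {1..m::nat}. even i} = m div 2"
proof (induction m)
  case (Suc m)
  have "{i \<in> {1..Suc m}. even i}
      = (if odd m then insert (Suc m) {i \<in> {1..m}. even i} else {i \<in> {1..m}. even i})"
    by (auto simp: le_Suc_eq)
  then show ?case using Suc by auto
qed simp

text \<open>The surplus over the even count is kept as \<open>of_bool\<close>, so that its sum over
  \<open>B\<close> becomes \<open>beta\<close>.\<close>

lemma card_odds_atMost: "card {i \<in> {1..m::nat}. odd i} = m div 2 + of_bool (odd m)"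
proof (induction m)
  case (Suc m)
  have "{i \<in> {1..Suc m}. odd i}
      = (if even m then insert (Suc m) {i \<in> {1..m}. odd i} else {i \<in> {1..m}. odd i})"
    by (auto simp: le_Suc_eq)
  then show ?case using Suc by auto
qed simp

text \<open>Pairs are grouped by their difference. Exchanging \<open>B\<close> and \<open>C\<close>
  merely swaps the two sums, so only the \<open>beta\<close> term can change.\<close>

lemma card_edge_pairs:
  assumes "B \<subseteq> {1..n - 1}" and "C \<subseteq> {1..n - 1}"
  shows "card (edge_pairs n B C)
    = beta n B C + (\<Sum>d\<in>B. (n - d) div 2) + (\<Sum>d\<in>C. (n - d) div 2)"
proof -
  let ?f = "\<lambda>(d, i). (i, i + d)"
  \<comment> \<open>Elements are (difference, smaller index), and \<open>?f\<close> rebuilds the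
    index pair. Parity of the second entry makes \<open>?O\<close> and \<open>?E\<close>
    disjoint.\<close>
  let ?O = "SIGMA d:B. {i \<in> {1..n - d}. odd i}" and ?E = "SIGMA d:C. {i \<in> {1..n - d}. even i}"
  have fin: "finite B" "finite C" using assms finite_subset by blast+
  have "edge_pairs n B C = ?f ` (?O \<union> ?E)"
  proof (intro equalityI subsetI)
    fix p assume "p \<in> edge_pairs n B C"
    then obtain i j where "p = (i, j)" "1 \<le> i" "i < j" "j \<le> n" "j - i \<in> (if odd i then B else C)"
      by (auto simp: edge_pairs_def)
    then show "p \<in> ?f ` (?O \<union> ?E)"
      by (intro image_eqI[of _ _ "(j - i, i)"]) (auto split: if_splits)
  next
    fix p assume "p \<in> ?f ` (?O \<union> ?E)"
    then obtain d i where p: "p = (i, i + d)" and di: "(d, i) \<in> ?O \<union> ?E" by auto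
    have "1 \<le> d" "d \<le> n - 1" using di assms by auto
    then show "p \<in> edge_pairs n B C"
      using p di by (auto simp: edge_pairs_def)
  qed
  moreover have "inj_on ?f (?O \<union> ?E)" by (auto simp: inj_on_def)
  ultimately have "card (edge_pairs n B C) = card (?O \<union> ?E)"
    by (simp add: card_image)
  also have "\<dots> = card ?O + card ?E"
    using fin by (intro card_Un_disjoint) auto
  also have "card ?O = (\<Sum>d\<in>B. card {i \<in> {1..n - d}. odd i})"
    using fin by (intro card_SigmaI) auto
  also have "\<dots> = (\<Sum>d\<in>B. (n - d) div 2) + (\<Sum>d\<in>B. of_bool (odd (n - d)))"
    by (simp only: card_odds_atMost sum.distrib)
  also have "(\<Sum>d\<in>B. of_bool (odd (n - d))) = beta n B C"
    unfolding beta_def using fin(1)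
    by (simp only: sum_of_bool_eq Int_def mem_Collect_eq of_nat_id)
  also have "card ?E = (\<Sum>d\<in>C. card {i \<in> {1..n - d}. even i})"
    using fin by (intro card_SigmaI) auto
  also have "\<dots> = (\<Sum>d\<in>C. (n - d) div 2)"
    by (simp only: card_evens_atMost)
  finally show ?thesis by simp
qed

theorem lemma5p7:
  fixes n :: nat and B C :: "nat set"
    and a :: "nat \<Rightarrow> 'v" and b a' :: "nat \<Rightarrow> 'w"
    and A :: "'v ugraph" and A' :: "'w ugraph"
  assumes "n \<ge> 3"
    and "B \<subseteq> {1..n - 1}" and "C \<subseteq> {1..n - 1}"
    and "inj_on a {1..n}" and "A = A_graph a n B C"
    and "inj_on b {1..n}" and "A' = A_graph b n C B"
    and "\<And>i. i \<in> {1..n} \<Longrightarrow> a' i = b (n - i + 1)"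
  shows "beta n B C = gamma n B C \<longleftrightarrow>
    card (edges A) = card (edges A') \<and>
    degree A (a 1) = degree A' (a' 1) \<and>
    degree A (a n) = degree A' (a' n)"
proof -
  have n: "n \<ge> 1" using assms(1) by simp
  have swap: "beta n C B = gamma n B C" "gamma n C B = beta n B C"
    by (simp_all add: beta_def gamma_def)
  \<comment> \<open>Reversing the numbering makes \<open>a' 1\<close> the last and
    \<open>a' n\<close> the first vertex of \<open>A'\<close>, so each degree condition compares a
    first with a last vertex.\<close>
  have ends: "a' 1 = b n" "a' n = b 1"
    using assms(8)[of 1] assms(8)[of n] n by simp_all
  have "card (edges A) = card (edges A') \<longleftrightarrow> beta n B C = gamma n B C"
    using card_edge_pairs[OF assms(2,3)] card_edge_pairs[OF assms(3,2)] swap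
    by (simp add: assms(5,7) card_edges_A_graph[OF assms(4)] card_edges_A_graph[OF assms(6)])
  moreover have "degree A (a 1) = card B"
    using degree_A_graph_first[OF assms(4,2) n] assms(5) by simp
  moreover have "degree A' (a' n) = card C"
    using degree_A_graph_first[OF assms(6,3) n] assms(7) ends by simp
  moreover have "degree A (a n) + gamma n B C = beta n B C + card C"
    using degree_A_graph_last[OF assms(4,2,3) n] assms(5) by simp
  moreover have "degree A' (a' 1) + beta n B C = gamma n B C + card B"
    using degree_A_graph_last[OF assms(6,3,2) n] assms(7) ends swap by simp
  \<comment> \<open>If \<open>beta\<close> equals \<open>gamma\<close>, they cancel in both
    last-vertex identities, leaving \<open>card C\<close> at \<open>a n\<close> and
    \<open>card B\<close> at \<open>a' 1\<close>, as at the opposite ends. The converse is the edge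
    count.\<close>
  ultimately show ?thesis by auto
qed

end
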